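(* The pentablock $\mathcal P\subset\mathbb C^3$ cannot be exhausted by domains biholomorphic to convex ones.
   Context: Let $\mathbb D$ be the open unit disc in $\mathbb C$ and let $\mathbb G_2=\{(s,p)\in\mathbb C^2:1-sz+pz^2\neq0\text{ for all }z\in\overline{\mathbb D}\}=\{(\lambda_1+\lambda_2,\lambda_1\lambda_2):\lambda_1,\lambda_2\in\mathbb D\}$ be the symmetrized bidisc. The pentablock is $$\mathcal P=\left\{(a,s,p)\in\mathbb C^3:(s,p)\in\mathbb G_2,\ |a|<\left|1-\frac{\frac12s\overline{\beta}}{1+\sqrt{1-|\beta|^2}}\right|\right\},\qquad \beta=\beta(s,p)=\frac{s-\overline{s}p}{1-|p|^2}.$$ A domain $D\subset\mathbb C^d$ can be exhausted by domains biholomorphic to convex ones if there are domains $D_1\subset D_2\subset\cdots$ with $\bigcup_jD_j=D$ such that each $D_j$ is biholomorphic to a convex domain. *)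

theory Defs
  imports "HOL-Analysis.Analysis"
begin

definition domain_in :: "(complex ^ 'n) set \<Rightarrow> bool" where
  "domain_in D \<longleftrightarrow> open D \<and> connected D \<and> D \<noteq> {}"

(* The has_derivative predicate only asks for a real-linear derivative; *s is the complex
   scalar multiplication of vectors, so the second conjunct makes it complex-linear. *)
definition holomorphic_map_on :: "(complex ^ 'n \<Rightarrow> complex ^ 'm) \<Rightarrow> (complex ^ 'n) set \<Rightarrow> bool" where
  "holomorphic_map_on f U \<longleftrightarrow>
     (\<forall>z\<in>U. \<exists>f'. (f has_derivative f') (at z within U) \<and> (\<forall>c v. f' (c *s v) = c *s f' v))"

definition biholomorphic :: "(complex ^ 'n) set \<Rightarrow> (complex ^ 'm) set \<Rightarrow> bool" where
  "biholomorphic U V \<longleftrightarrow>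
     (\<exists>f g. holomorphic_map_on f U \<and> holomorphic_map_on g V \<and>
        f ` U = V \<and> g ` V = U \<and>
        (\<forall>z\<in>U. g (f z) = z) \<and> (\<forall>w\<in>V. f (g w) = w))"

definition exhausted_by_biholomorphically_convex :: "(complex ^ 'n) set \<Rightarrow> bool" where
  "exhausted_by_biholomorphically_convex D \<longleftrightarrow>
     (\<exists>E :: nat \<Rightarrow> (complex ^ 'n) set.
        (\<forall>j. domain_in (E j)) \<and> (\<forall>j. E j \<subseteq> E (Suc j)) \<and> (\<Union>j. E j) = D \<and>
        (\<forall>j. \<exists>C :: (complex ^ 'n) set. domain_in C \<and> convex C \<and> biholomorphic (E j) C))"

definition symmetrized_bidisc :: "(complex \<times> complex) set" where
  "symmetrized_bidisc = {(s, p). \<forall>z\<in>cball 0 1. 1 - s * z + p * z\<^sup>2 \<noteq> 0}"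

definition pentablock_beta :: "complex \<Rightarrow> complex \<Rightarrow> complex" where
  "pentablock_beta s p = (s - cnj s * p) / of_real (1 - (cmod p)\<^sup>2)"

(* The coordinates (a, s, p) are the components 1, 2, 3. Where (s, p) lies in the symmetrized
   bidisc, |p| < 1 and |beta| < 1, so neither the division nor the real square root is degenerate. *)
definition pentablock :: "(complex ^ 3) set" where
  "pentablock = {x. let a = x $ 1; s = x $ 2; p = x $ 3; b = pentablock_beta s p in
     (s, p) \<in> symmetrized_bidisc \<and>
     cmod a < cmod (1 - (1/2 * s * cnj b) / of_real (1 + sqrt (1 - (cmod b)\<^sup>2)))}"

end

theory Submission
  imports Defs "HOL-Complex_Analysis.Complex_Analysis"
begin

text \<open>
  Write \<open>G\<close> for the symmetrized bidisc. Points \<open>(0, s, p)\<close> with \<open>(s, p)\<close> in \<open>G\<close> lie in the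
  pentablock, and the last two coordinates of any point of the pentablock lie in \<open>G\<close>. The
  obstruction already lives in this slice and comes from the weighted action
  \<open>t \<cdot> (s, p) = (t s, t\<^sup>2 p)\<close>.
  
  Suppose that a subdomain \<open>E\<close> of the pentablock contains the orbits, over the closed unit disc, of
  \<open>(0, s, p)\<close> and \<open>(0, s', p')\<close>, and that \<open>f\<close> maps \<open>E\<close> biholomorphically onto a convex domain. For
  each \<open>t\<close> take the midpoint of the images of the two orbit points and pull it back by \<open>f\<close>.
  This gives a holomorphic curve \<open>\<phi>\<close> in \<open>E\<close>. Its second and third coordinates divided by \<open>t\<close> and
  \<open>t\<^sup>2\<close> extend over \<open>t = 0\<close>, with the values \<open>\<sigma> = (s + s') / 2\<close> and
  \<open>\<pi> = (p + p') / 2 + (s - s')\<^sup>2 k / 4\<close>, where the complex number \<open>k\<close> is determined by the second-order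
  behaviour of \<open>f\<close> at \<open>0\<close> and is the same for all pairs of orbits
  (\<open>midpoint_curve_expansion\<close>). On the unit circle the divided curve stays in \<open>G\<close> because \<open>G\<close> is
  invariant under rotations. Applying the maximum principle to the functions
  \<open>(2 t\<^sup>2 p - t s) / (2 - t s)\<close>, which are bounded by \<open>1\<close> on \<open>G\<close>, shows that \<open>(\<sigma>, \<pi>)\<close> satisfies
  the same bounds (\<open>analytic_disc_center_bound\<close>, \<open>sheared_midpoint_bound\<close>).
  
  No \<open>k\<close> is compatible with these bounds. Up to a factor close to \<open>1\<close>, the points \<open>(2, 1)\<close> and
  \<open>(0, - 1)\<close> have the sheared midpoint \<open>(1, k)\<close>, which keeps \<open>Re k\<close> from being very negative, and
  the points \<open>(2, 1)\<close> and \<open>(2 \<i>, - 1)\<close> have the sheared midpoint \<open>(1 + \<i>, - 2 \<i> k)\<close>, which forces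
  \<open>Re k\<close> to be quite negative (\<open>sheared_bidisc_not_convex\<close>). The orbits in question form a compact
  subset of the pentablock, so some member of any exhaustion by open sets contains them all.
\<close>

(* The dollar sign denotes the components of vectors only. *)
no_notation fps_nth (infixl "$" 75)

section \<open>Complex curves and lines under holomorphic maps\<close>

lemma norm_complex_vector_scalar_mult:
  fixes v :: "complex ^ 'n"
  shows "norm (c *s v) = norm c * norm v"
  by (simp add: norm_vec_def norm_mult L2_set_right_distrib)

lemma norm_vec_le_sum_norm:
  fixes v :: "complex ^ 'n"
  shows "norm v \<le> (\<Sum>i\<in>UNIV. norm (v $ i))"
  unfolding norm_vec_def by (rule L2_set_le_sum) simp

lemma tendsto_vector_scalar_mult:
  fixes x :: "'t \<Rightarrow> complex ^ 'n"
  assumes "(c \<longlongrightarrow> a) F" "(x \<longlongrightarrow> v) F"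
  shows "((\<lambda>t. c t *s x t) \<longlongrightarrow> a *s v) F"
proof (rule vec_tendstoI)
  fix i
  show "((\<lambda>t. (c t *s x t) $ i) \<longlongrightarrow> (a *s v) $ i) F"
    unfolding vector_smult_component by (intro tendsto_mult tendsto_vec_nth assms)
qed

lemma has_derivative_vector_scalar_mult_left:
  fixes v :: "complex ^ 'n"
  shows "((\<lambda>t. t *s v) has_derivative (\<lambda>t. t *s v)) F"
proof (rule bounded_linear_imp_has_derivative, rule bounded_linear_intro[where K = "norm v"])
  show "(s + t) *s v = s *s v + t *s v" for s t
    by (rule vector_sadd_rdistrib)
  show "(r *\<^sub>R t) *s v = r *\<^sub>R (t *s v)" for r t
    by (vector scaleR_conv_of_real mult.assoc)
  show "norm (t *s v) \<le> norm t * norm v" for t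
    by (rule eq_refl) (rule norm_complex_vector_scalar_mult)
qed

lemma holomorphic_map_onE:
  assumes "holomorphic_map_on f U" "open U" "z \<in> U"
  obtains D where "(f has_derivative D) (at z)" "\<And>c v. D (c *s v) = c *s D v"
proof -
  obtain D where D: "(f has_derivative D) (at z within U)" "\<forall>c v. D (c *s v) = c *s D v"
    using assms(1,3) unfolding holomorphic_map_on_def by blast
  have "(f has_derivative D) (at z)"
    using D(1) unfolding at_within_open[OF assms(3,2)] .
  with D(2) show ?thesis by (intro that) auto
qed

lemma continuous_on_holomorphic_map:
  assumes "holomorphic_map_on f U"
  shows "continuous_on U f"
  unfolding continuous_on_eq_continuous_within
proof
  fix z assume "z \<in> U"
  then obtain D where "(f has_derivative D) (at z within U)"
    using assms unfolding holomorphic_map_on_def by blast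
  then show "continuous (at z within U) f" by (rule has_derivative_continuous)
qed

lemma has_field_derivative_along_line:
  fixes f :: "complex ^ 'n \<Rightarrow> complex ^ 'm"
  assumes "(f has_derivative D) (at (x + t *s v))" "\<And>c v. D (c *s v) = c *s D v"
  shows "((\<lambda>t. f (x + t *s v) $ i) has_field_derivative D v $ i) (at t)"
proof -
  have "((\<lambda>t. x + t *s v) has_derivative (\<lambda>t. 0 + t *s v)) (at t)"
    by (intro has_derivative_add has_derivative_const has_derivative_vector_scalar_mult_left)
  then have "((\<lambda>t. f (x + t *s v)) has_derivative (\<lambda>t. D (0 + t *s v))) (at t)"
    using assms(1) by (rule has_derivative_compose)
  then have "((\<lambda>t. f (x + t *s v) $ i) has_derivative (\<lambda>t. D (0 + t *s v) $ i)) (at t)"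
    by (rule bounded_linear.has_derivative[OF bounded_linear_vec_nth])
  moreover have "(\<lambda>t. D (0 + t *s v) $ i) = (*) (D v $ i)"
    by (simp add: assms(2) mult.commute fun_eq_iff)
  ultimately show ?thesis
    by (simp add: has_field_derivative_def)
qed

lemma holomorphic_on_along_line:
  assumes "holomorphic_map_on f U" "open U" "\<And>t. t \<in> T \<Longrightarrow> x + t *s v \<in> U"
  shows "(\<lambda>t. f (x + t *s v) $ i) holomorphic_on T"
  unfolding holomorphic_on_def
proof
  fix t assume "t \<in> T"
  then obtain D where "(f has_derivative D) (at (x + t *s v))" "\<And>c v. D (c *s v) = c *s D v"
    using holomorphic_map_onE[OF assms(1,2)] assms(3) by metis
  from has_field_derivative_along_line[OF this]
  show "(\<lambda>t. f (x + t *s v) $ i) field_differentiable at t within T"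
    using field_differentiable_at_within field_differentiable_def by blast
qed

section \<open>Holomorphic maps are strictly differentiable\<close>

text \<open>
  The two derivatives are compared along one direction \<open>v\<close> at a time: \<open>D v - D' v\<close> is the
  derivative at \<open>0\<close> of the one-variable function \<open>t \<mapsto> f (x + t v) - f (y + t v)\<close>, and Cauchy's
  inequality on the largest disc on which \<open>norm (t v)\<close> stays below \<open>\<rho>\<close> bounds that
  derivative by the size of the function itself. The factor \<open>CARD('m)\<close> comes from adding up
  the components.
\<close>

lemma derivative_difference_bound:
  fixes f :: "complex ^ 'n \<Rightarrow> complex ^ 'm" and \<epsilon> \<rho> :: real
  assumes f: "holomorphic_map_on f U" "open U" and \<rho>: "\<rho> > 0"
    and sub: "cball x \<rho> \<subseteq> U" "cball y \<rho> \<subseteq> U"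
    and Dx: "(f has_derivative D) (at x)" "\<And>c v. D (c *s v) = c *s D v"
    and Dy: "(f has_derivative D') (at y)" "\<And>c v. D' (c *s v) = c *s D' v"
    and bound: "\<And>w. norm w \<le> \<rho> \<Longrightarrow> norm (f (x + w) - f (y + w)) \<le> \<epsilon>"
  shows "norm (D v - D' v) \<le> CARD('m) * \<epsilon> / \<rho> * norm v"
proof (cases "v = 0")
  case True
  then show ?thesis
    using Dx(1) Dy(1) by (simp add: linear_0[OF has_derivative_linear])
next
  case False
  define r where "r = \<rho> / norm v"
  have r: "r > 0" using \<rho> False by (simp add: r_def)
  have small: "norm (t *s v) \<le> \<rho>" if "norm t \<le> r" for t
    using that False by (simp add: norm_complex_vector_scalar_mult r_def field_simps)
  have inU: "x + t *s v \<in> U" "y + t *s v \<in> U" if "t \<in> cball 0 r" for t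
    using small[of t] that by (intro subsetD[OF sub(1)] subsetD[OF sub(2)]; simp add: dist_norm)+
  have comp: "norm ((D v - D' v) $ i) \<le> \<epsilon> / r" for i
  proof -
    let ?h = "\<lambda>t. f (x + t *s v) $ i - f (y + t *s v) $ i"
    have hol: "?h holomorphic_on cball 0 r"
      by (intro holomorphic_on_diff holomorphic_on_along_line[OF f] inU) auto
    have "norm ((deriv ^^ 1) ?h 0) \<le> fact 1 * \<epsilon> / r ^ 1"
    proof (rule Cauchy_inequality)
      show "?h holomorphic_on ball 0 r"
        using hol by (rule holomorphic_on_subset) auto
      show "continuous_on (cball 0 r) ?h"
        using hol by (rule holomorphic_on_imp_continuous_on)
      fix t :: complex assume "norm (0 - t) = r"
      then show "norm (?h t) \<le> \<epsilon>"
        using bound[OF small, of t] Finite_Cartesian_Product.norm_nth_le[of "f (x + t *s v) - f (y + t *s v)" i]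
        by simp
    qed (use r in auto)
    moreover have "(?h has_field_derivative D v $ i - D' v $ i) (at 0)"
      by (intro derivative_intros has_field_derivative_along_line)
        (use Dx Dy in auto)
    ultimately show ?thesis
      by (simp add: DERIV_imp_deriv)
  qed
  have "norm (D v - D' v) \<le> (\<Sum>i\<in>(UNIV::'m set). \<epsilon> / r)"
    by (rule order_trans[OF norm_vec_le_sum_norm sum_mono[OF comp]])
  also have "\<dots> = CARD('m) * \<epsilon> / \<rho> * norm v"
    using False by (simp add: r_def)
  finally show ?thesis .
qed

text \<open>
  Complex differentiability at every point forces the derivative to be continuous, by the bound
  above and the uniform continuity of \<open>f\<close> on a compact ball. The mean value inequality for
  \<open>f - D\<close> then makes the linear approximation uniform in both arguments. This two-point form is
  what allows second-order information to pass through a map about which only a first derivative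
  is given.
\<close>

lemma holomorphic_map_strict_derivative:
  fixes f :: "complex ^ 'n \<Rightarrow> complex ^ 'm"
  assumes f: "holomorphic_map_on f U" "open U" and z: "z \<in> U"
    and D: "(f has_derivative D) (at z)" "\<And>c v. D (c *s v) = c *s D v" and "e > 0"
  obtains d where "d > 0"
    "\<And>x y. x \<in> ball z d \<Longrightarrow> y \<in> ball z d \<Longrightarrow> norm (f x - f y - D (x - y)) \<le> e * norm (x - y)"
proof -
  obtain R where R: "R > 0" "cball z R \<subseteq> U"
    using f(2) z open_contains_cball by blast
  \<comment> \<open>Half of the radius, so that a translate by \<open>\<rho>\<close> of a point close to \<open>z\<close> stays in the
    compact ball of radius \<open>R\<close>.\<close>
  define \<rho> where "\<rho> = R / 2"
  have \<rho>: "\<rho> > 0" using R by (simp add: \<rho>_def)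
  define \<epsilon> where "\<epsilon> = e * \<rho> / CARD('m)"
  have \<epsilon>: "\<epsilon> > 0" using \<rho> \<open>e > 0\<close> by (simp add: \<epsilon>_def)
  have "uniformly_continuous_on (cball z R) f"
    by (intro compact_uniformly_continuous continuous_on_subset[OF continuous_on_holomorphic_map[OF f(1)] R(2)]
        compact_cball)
  then obtain \<delta> where \<delta>: "\<delta> > 0"
    "\<And>x y. x \<in> cball z R \<Longrightarrow> y \<in> cball z R \<Longrightarrow> dist x y < \<delta> \<Longrightarrow> dist (f x) (f y) < \<epsilon>"
    using \<epsilon> unfolding uniformly_continuous_on_def by metis
  define d where "d = min \<delta> \<rho>"
  have "d > 0" using \<delta> \<rho> by (simp add: d_def)
  have "\<forall>x\<in>U. \<exists>D. (f has_derivative D) (at x) \<and> (\<forall>c v. D (c *s v) = c *s D v)"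
    using holomorphic_map_onE[OF f] by metis
  then obtain DD where DD: "\<And>x. x \<in> U \<Longrightarrow> (f has_derivative DD x) (at x)"
    "\<And>x c v. x \<in> U \<Longrightarrow> DD x (c *s v) = c *s DD x v"
    by metis
  have ballR: "x + w \<in> cball z R" if "x \<in> ball z d" "norm w \<le> \<rho>" for x w
  proof -
    have "dist z (x + w) \<le> dist z x + norm w"
      using dist_triangle[of z "x + w" x] by (simp add: dist_norm[of x])
    then show ?thesis using that by (simp add: d_def \<rho>_def)
  qed
  have sub: "cball x \<rho> \<subseteq> U" if "x \<in> ball z d" for x
  proof
    fix y assume "y \<in> cball x \<rho>"
    then have "norm (y - x) \<le> \<rho>" by (simp add: dist_commute flip: dist_norm)
    from ballR[OF that this] show "y \<in> U" using R(2) by auto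
  qed
  have on: "onorm (\<lambda>v. DD x v - D v) \<le> e" if x: "x \<in> ball z d" for x
  proof (rule onorm_le)
    fix v
    have "norm (DD x v - D v) \<le> CARD('m) * \<epsilon> / \<rho> * norm v"
    proof (rule derivative_difference_bound[OF f \<rho> sub[OF x] sub])
      show "z \<in> ball z d" using \<open>d > 0\<close> by simp
      have "x \<in> U" using \<rho> by (intro subsetD[OF sub[OF x]]) simp
      then show "(f has_derivative DD x) (at x)" "\<And>c v. DD x (c *s v) = c *s DD x v"
        using DD by auto
      show "norm (f (x + w) - f (z + w)) \<le> \<epsilon>" if "norm w \<le> \<rho>" for w
      proof -
        have "dist (x + w) (z + w) < \<delta>"
          using x by (simp add: dist_commute d_def)
        from \<delta>(2)[OF ballR[OF x that] ballR[OF \<open>z \<in> ball z d\<close> that] this]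
        show ?thesis by (simp add: dist_norm)
      qed
    qed (use D in auto)
    then show "norm (DD x v - D v) \<le> e * norm v"
      using \<rho> by (simp add: \<epsilon>_def)
  qed
  show ?thesis
  proof
    fix x y assume xy: "x \<in> ball z d" "y \<in> ball z d"
    have "norm ((f x - D x) - (f y - D y)) \<le> e * norm (x - y)"
    proof (rule differentiable_bound[where S = "ball z d"])
      fix x assume x: "x \<in> ball z d"
      then have "x \<in> U" using \<rho> by (intro subsetD[OF sub[OF x]]) simp
      have "bounded_linear D" using D(1) by (rule has_derivative_bounded_linear)
      then have "(D has_derivative D) (at x)" by (rule bounded_linear_imp_has_derivative)
      then show "((\<lambda>x. f x - D x) has_derivative (\<lambda>v. DD x v - D v)) (at x within ball z d)"
        using has_derivative_diff[OF DD(1)[OF \<open>x \<in> U\<close>]] has_derivative_at_withinI by blast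
    qed (use xy on in auto)
    moreover have "D (x - y) = D x - D y"
      by (rule linear_diff[OF has_derivative_linear[OF D(1)]])
    moreover have "f x - f y - (D x - D y) = (f x - D x) - (f y - D y)"
      by simp
    ultimately show "norm (f x - f y - D (x - y)) \<le> e * norm (x - y)"
      by metis
  qed fact
qed

section \<open>The second-order expansion of a midpoint\<close>

text \<open>
  If two curves through \<open>z\<close> differ by \<open>w / r\<close> to leading order, then their images differ by
  \<open>D w / r\<close> to leading order, however large the scale \<open>r\<close> is. With \<open>r = 1 / t\<^sup>2\<close> this replaces
  a second-order Taylor formula in several variables.
\<close>

lemma tendsto_rescaled_image_difference:
  fixes f :: "complex ^ 'n \<Rightarrow> complex ^ 'm"
  assumes f: "holomorphic_map_on f U" "open U" and z: "z \<in> U"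
    and D: "(f has_derivative D) (at z)" "\<And>c v. D (c *s v) = c *s D v"
    and x: "(x \<longlongrightarrow> z) F" and y: "(y \<longlongrightarrow> z) F"
    and w: "((\<lambda>t. r t *s (x t - y t)) \<longlongrightarrow> w) F"
  shows "((\<lambda>t. r t *s (f (x t) - f (y t))) \<longlongrightarrow> D w) F"
proof -
  let ?E = "\<lambda>t. f (x t) - f (y t) - D (x t - y t)"
  have "((\<lambda>t. D (r t *s (x t - y t))) \<longlongrightarrow> D w) F"
    using has_derivative_bounded_linear[OF D(1)] w by (rule bounded_linear.tendsto)
  moreover have "((\<lambda>t. r t *s ?E t) \<longlongrightarrow> 0) F"
  proof (rule tendstoI)
    fix \<epsilon> :: real assume "\<epsilon> > 0"
    define e where "e = \<epsilon> / (norm w + 1)"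
    have pos: "norm w + 1 > 0" by (simp add: add_nonneg_pos)
    then have "e > 0" using \<open>\<epsilon> > 0\<close> by (simp add: e_def)
    obtain d where d: "d > 0"
      "\<And>x y. x \<in> ball z d \<Longrightarrow> y \<in> ball z d \<Longrightarrow> norm (f x - f y - D (x - y)) \<le> e * norm (x - y)"
      using holomorphic_map_strict_derivative[OF f z D \<open>e > 0\<close>] by metis
    have "eventually (\<lambda>t. norm (r t *s (x t - y t)) < norm w + 1) F"
      using tendsto_norm[OF w] by (rule order_tendstoD) simp
    moreover have "eventually (\<lambda>t. dist (x t) z < d) F" "eventually (\<lambda>t. dist (y t) z < d) F"
      using x y \<open>d > 0\<close> by (auto dest: tendstoD)
    ultimately show "eventually (\<lambda>t. dist (r t *s ?E t) 0 < \<epsilon>) F"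
    proof eventually_elim
      case (elim t)
      have "norm (?E t) \<le> e * norm (x t - y t)"
        using elim by (intro d(2)) (auto simp: dist_commute)
      then have "norm (r t *s ?E t) \<le> e * norm (r t *s (x t - y t))"
        unfolding norm_complex_vector_scalar_mult
        using mult_left_mono[of "norm (?E t)" "e * norm (x t - y t)" "norm (r t)"]
        by (simp only: norm_ge_zero mult.left_commute)
      also have "\<dots> < e * (norm w + 1)"
        using elim(1) \<open>e > 0\<close> by (rule mult_strict_left_mono)
      also have "\<dots> = \<epsilon>" using pos by (simp add: e_def)
      finally show ?case by simp
    qed
  qed
  ultimately have "((\<lambda>t. D (r t *s (x t - y t)) + r t *s ?E t) \<longlongrightarrow> D w + 0) F"
    by (rule tendsto_add)
  moreover have "D (r t *s (x t - y t)) + r t *s ?E t = r t *s (f (x t) - f (y t))" for t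
    unfolding D(2) by simp
  ultimately show ?thesis
    by simp
qed

text \<open>
  The difference quotient of \<open>h\<close> at \<open>0\<close> extends holomorphically over \<open>0\<close>; the limit is the
  derivative of this extension.
\<close>

lemma second_order_coefficient_exists:
  fixes h :: "complex \<Rightarrow> complex"
  assumes h: "h holomorphic_on N" and N: "open N" "0 \<in> N"
    and h': "(h has_field_derivative h') (at 0)"
  shows "\<exists>b. ((\<lambda>t. (1 / t\<^sup>2) * (h t - h 0 - t * h')) \<longlongrightarrow> b) (at 0)"
proof -
  define q where "q = (\<lambda>t. if t = 0 then deriv h 0 else (h t - h 0) / (t - 0))"
  have "q holomorphic_on N"
    unfolding q_def by (rule pole_lemma_open[OF h N(1)])
  then have "(q has_field_derivative deriv q 0) (at 0)"
    using N holomorphic_derivI by blast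
  then have "((\<lambda>t. (q t - q 0) / (t - 0)) \<longlongrightarrow> deriv q 0) (at 0)"
    by (simp add: has_field_derivative_iff)
  moreover have "eventually (\<lambda>t. (q t - q 0) / (t - 0) = (1 / t\<^sup>2) * (h t - h 0 - t * h')) (at 0)"
  proof -
    have "(q t - q 0) / (t - 0) = (1 / t\<^sup>2) * (h t - h 0 - t * h')" if "t \<noteq> 0" for t
      using that DERIV_imp_deriv[OF h'] by (simp add: q_def field_simps power2_eq_square)
    then show ?thesis by (simp add: eventually_at_filter)
  qed
  ultimately show ?thesis
    by (blast intro: Lim_transform_eventually)
qed

lemma tendsto_line:
  fixes u :: "complex ^ 'n"
  assumes "(c \<longlongrightarrow> 0) F"
  shows "((\<lambda>t. z + c t *s u) \<longlongrightarrow> z) F"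
  using tendsto_add[OF tendsto_const tendsto_vector_scalar_mult[OF assms tendsto_const], of z u]
  by simp

lemma open_line_preimage:
  fixes u :: "complex ^ 'n"
  assumes "open U"
  shows "open {t. z + t *s u \<in> U}"
proof -
  have "continuous_on UNIV (\<lambda>t. z + t *s u)"
    unfolding continuous_on_def
    by (intro ballI tendsto_add tendsto_const tendsto_vector_scalar_mult tendsto_ident_at)
  then show ?thesis using open_vimage[OF assms] by (simp add: vimage_def)
qed

text \<open>
  On a complex line the map is a tuple of one-variable functions, so the quadratic term of its
  expansion exists, and it is homogeneous of degree two in the direction.
\<close>

lemma second_order_term_along_line:
  fixes f :: "complex ^ 'n \<Rightarrow> complex ^ 'm"
  assumes f: "holomorphic_map_on f U" "open U" and z: "z \<in> U"
    and D: "(f has_derivative D) (at z)" "\<And>c v. D (c *s v) = c *s D v"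
  shows "\<exists>b. \<forall>s. ((\<lambda>t. (1 / t\<^sup>2) *s (f (z + (t * s) *s u) - f z - (t * s) *s D u)) \<longlongrightarrow> s\<^sup>2 *s b) (at 0)"
proof -
  have "\<exists>b. ((\<lambda>t. (1 / t\<^sup>2) * (f (z + t *s u) $ i - f z $ i - t * D u $ i)) \<longlongrightarrow> b) (at 0)" for i
  proof -
    let ?N = "{t. z + t *s u \<in> U}" and ?h = "\<lambda>t. f (z + t *s u) $ i"
    have "?h holomorphic_on ?N"
      by (rule holomorphic_on_along_line[OF f]) simp
    moreover have "(?h has_field_derivative D u $ i) (at 0)"
      by (rule has_field_derivative_along_line) (use D in auto)
    ultimately have "\<exists>b. ((\<lambda>t. (1 / t\<^sup>2) * (?h t - ?h 0 - t * D u $ i)) \<longlongrightarrow> b) (at 0)"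
      using z by (intro second_order_coefficient_exists[OF _ open_line_preimage[OF f(2)]]) auto
    then show ?thesis by simp
  qed
  then have "\<exists>b. \<forall>i. ((\<lambda>t. (1 / t\<^sup>2) * (f (z + t *s u) $ i - f z $ i - t * D u $ i)) \<longlongrightarrow> b i) (at 0)"
    by (intro choice allI)
  then obtain b where
    b: "\<And>i. ((\<lambda>t. (1 / t\<^sup>2) * (f (z + t *s u) $ i - f z $ i - t * D u $ i)) \<longlongrightarrow> b i) (at 0)"
    by blast
  let ?Q = "\<lambda>t. (1 / t\<^sup>2) *s (f (z + t *s u) - f z - t *s D u)"
  have lim: "(?Q \<longlongrightarrow> vec_lambda b) (at 0)"
    by (rule vec_tendstoI)
      (simp only: vector_smult_component vector_minus_component vec_lambda_beta b)
  show ?thesis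
  proof (intro exI allI)
    fix s :: complex
    show "((\<lambda>t. (1 / t\<^sup>2) *s (f (z + (t * s) *s u) - f z - (t * s) *s D u)) \<longlongrightarrow> s\<^sup>2 *s vec_lambda b) (at 0)"
    proof (cases "s = 0")
      case True
      then show ?thesis by simp
    next
      case False
      have "((\<lambda>t. t * s) \<longlongrightarrow> 0) (at 0)"
        using tendsto_mult_left_zero[OF tendsto_ident_at] .
      then have "filterlim (\<lambda>t. t * s) (at 0) (at 0)"
        using False by (intro filterlim_atI) (auto simp: eventually_at_filter)
      then have "((\<lambda>t. s\<^sup>2 *s ?Q (t * s)) \<longlongrightarrow> s\<^sup>2 *s vec_lambda b) (at 0)"
        by (intro tendsto_vector_scalar_mult tendsto_const filterlim_compose[OF lim])
      then show ?thesis
        using False by (simp add: vector_smult_assoc power_mult_distrib)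
    qed
  qed
qed

text \<open>
  Join the two curves \<open>z + t s u + t\<^sup>2 v\<close> and \<open>z + t s' u + t\<^sup>2 v'\<close> by the midpoint taken in the
  image of \<open>f\<close> and pulled back by \<open>g\<close>. Along \<open>f\<close> the second-order term of the first curve is
  \<open>s\<^sup>2 b + D v\<close>, where \<open>b\<close> is the quadratic term of \<open>f\<close> along the line in direction \<open>u\<close>. Pulling
  back subtracts the quadratic term \<open>\<sigma>\<^sup>2 b\<close> of the averaged slope \<open>\<sigma> = (s + s') / 2\<close>, and
  \<open>(s\<^sup>2 + s'\<^sup>2) / 2 - \<sigma>\<^sup>2 = (s - s')\<^sup>2 / 4\<close>. So the nonlinearity of \<open>f\<close> enters only through the single
  vector \<open>q\<close>, the image of \<open>b\<close> under the derivative of \<open>g\<close>, and this vector is the same for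
  all pairs of curves.
\<close>

lemma midpoint_curve_expansion:
  fixes f :: "complex ^ 'n \<Rightarrow> complex ^ 'm" and u :: "complex ^ 'n"
  assumes f: "holomorphic_map_on f U" "open U" and z: "z \<in> U"
    and g: "holomorphic_map_on g V" "open V"
    and gf: "\<And>w. w \<in> U \<Longrightarrow> f w \<in> V \<and> g (f w) = w"
  obtains q where
    "\<And>s s' v v'. ((\<lambda>t. (1 / t\<^sup>2) *s
        (g ((1/2) *s (f (z + (t * s) *s u + t\<^sup>2 *s v) + f (z + (t * s') *s u + t\<^sup>2 *s v')))
          - (z + (t * ((s + s') / 2)) *s u)))
      \<longlongrightarrow> (1/2) *s (v + v') + ((s - s')\<^sup>2 / 4) *s q) (at 0)"
proof -
  obtain D where D: "(f has_derivative D) (at z)" "\<And>c v. D (c *s v) = c *s D v"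
    using holomorphic_map_onE[OF f z] by metis
  have fz: "f z \<in> V" using gf z by blast
  obtain D' where D': "(g has_derivative D') (at (f z))" "\<And>c v. D' (c *s v) = c *s D' v"
    using holomorphic_map_onE[OF g fz] by metis
  have "((\<lambda>w. g (f w)) has_derivative (\<lambda>v. D' (D v))) (at z)"
    using D(1) D'(1) by (rule has_derivative_compose)
  moreover have "((\<lambda>w. g (f w)) has_derivative (\<lambda>v. v)) (at z)"
    by (rule has_derivative_transform_within_open[OF has_derivative_ident f(2) z]) (simp add: gf)
  ultimately have "(\<lambda>v. D' (D v)) = (\<lambda>v. v)"
    by (rule has_derivative_unique)
  then have D'D: "D' (D v) = v" for v by metis
  obtain b where b: 
    "\<And>s. ((\<lambda>t. (1 / t\<^sup>2) *s (f (z + (t * s) *s u) - f z - (t * s) *s D u)) \<longlongrightarrow> s\<^sup>2 *s b) (at 0)"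
    using second_order_term_along_line[OF f z D, of u] by blast
  have cont: "continuous (at z) f" using D(1) by (rule has_derivative_continuous)
  have line: "((\<lambda>t. z + (t * s) *s u) \<longlongrightarrow> z) (at 0)" for s
    by (intro tendsto_line tendsto_mult_left_zero tendsto_ident_at)
  have "((\<lambda>t::complex. t\<^sup>2) \<longlongrightarrow> 0\<^sup>2) (at 0)" by (intro tendsto_intros)
  then have sq: "((\<lambda>t::complex. t\<^sup>2) \<longlongrightarrow> 0) (at 0)" by simp
  have curve: "((\<lambda>t. z + (t * s) *s u + t\<^sup>2 *s v) \<longlongrightarrow> z) (at 0)" for s v
    using tendsto_add[OF line[of s] tendsto_line[OF sq, of 0 v]] by simp
  have f_tendsto: "((\<lambda>t. f (x t)) \<longlongrightarrow> f z) (at 0)" if "(x \<longlongrightarrow> z) (at (0::complex))" for x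
    using isCont_tendsto_compose[OF cont that] .
  have A: "((\<lambda>t. (1 / t\<^sup>2) *s (f (z + (t * s) *s u + t\<^sup>2 *s v) - f z - (t * s) *s D u))
      \<longlongrightarrow> s\<^sup>2 *s b + D v) (at 0)" for s v
  proof -
    have "((\<lambda>t. (1 / t\<^sup>2) *s ((z + (t * s) *s u + t\<^sup>2 *s v) - (z + (t * s) *s u))) \<longlongrightarrow> v) (at 0)"
      by (rule tendsto_eventually) (simp add: eventually_at_filter vector_smult_assoc)
    from tendsto_rescaled_image_difference[OF f z D curve line this]
    have "((\<lambda>t. (1 / t\<^sup>2) *s (f (z + (t * s) *s u + t\<^sup>2 *s v) - f (z + (t * s) *s u))) \<longlongrightarrow> D v) (at 0)" .
    from tendsto_add[OF b this]
    have "((\<lambda>t. (1 / t\<^sup>2) *s (f (z + (t * s) *s u) - f z - (t * s) *s D u)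
        + (1 / t\<^sup>2) *s (f (z + (t * s) *s u + t\<^sup>2 *s v) - f (z + (t * s) *s u))) \<longlongrightarrow> s\<^sup>2 *s b + D v) (at 0)" .
    moreover have "c *s (P - F - E) + c *s (Q - P) = c *s (Q - F - E)" for c and P Q F E :: "complex ^ 'm"
      by (simp add: algebra_simps)
    ultimately show ?thesis by (simp only:)
  qed
  show ?thesis
  proof
    fix s s' :: complex and v v' :: "complex ^ 'n"
    define \<sigma> where "\<sigma> = (s + s') / 2"
    let ?h = "\<lambda>t. (1/2) *s (f (z + (t * s) *s u + t\<^sup>2 *s v) + f (z + (t * s') *s u + t\<^sup>2 *s v'))"
    let ?l = "\<lambda>t. z + (t * \<sigma>) *s u"
    let ?w = "(1/2) *s ((s\<^sup>2 *s b + D v) + (s'\<^sup>2 *s b + D v')) - \<sigma>\<^sup>2 *s b"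
    have mean: "(1/2) * (a * (P - F - t * s * d) + a * (Q - F - t * s' * d))
        - a * (R - F - t * ((s + s') / 2) * d) = a * ((1/2) * (P + Q) - R)" for a P Q R F d t :: complex
      by (simp add: field_simps)
    have h: "(?h \<longlongrightarrow> f z) (at 0)"
    proof -
      have "(?h \<longlongrightarrow> (1/2) *s (f z + f z)) (at 0)"
        by (intro tendsto_vector_scalar_mult tendsto_const tendsto_add f_tendsto curve)
      moreover have "(1/2) *s (f z + f z) = f z" by (simp add: vec_eq_iff)
      ultimately show ?thesis by simp
    qed
    have "((\<lambda>t. (1/2) *s ((1 / t\<^sup>2) *s (f (z + (t * s) *s u + t\<^sup>2 *s v) - f z - (t * s) *s D u)
        + (1 / t\<^sup>2) *s (f (z + (t * s') *s u + t\<^sup>2 *s v') - f z - (t * s') *s D u))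
        - (1 / t\<^sup>2) *s (f (?l t) - f z - (t * \<sigma>) *s D u)) \<longlongrightarrow> ?w) (at 0)"
      by (intro tendsto_diff tendsto_vector_scalar_mult[OF tendsto_const] tendsto_add A b)
    moreover have "(\<lambda>t. (1/2) *s ((1 / t\<^sup>2) *s (f (z + (t * s) *s u + t\<^sup>2 *s v) - f z - (t * s) *s D u)
        + (1 / t\<^sup>2) *s (f (z + (t * s') *s u + t\<^sup>2 *s v') - f z - (t * s') *s D u))
        - (1 / t\<^sup>2) *s (f (?l t) - f z - (t * \<sigma>) *s D u)) = (\<lambda>t. (1 / t\<^sup>2) *s (?h t - f (?l t)))"
      by (simp only: fun_eq_iff vec_eq_iff vector_smult_component vector_minus_component
          vector_add_component mean \<sigma>_def simp_thms)
    ultimately have "((\<lambda>t. (1 / t\<^sup>2) *s (?h t - f (?l t))) \<longlongrightarrow> ?w) (at 0)" by metis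
    from tendsto_rescaled_image_difference[OF g fz D' h f_tendsto[OF line] this]
    have lim: "((\<lambda>t. (1 / t\<^sup>2) *s (g (?h t) - g (f (?l t)))) \<longlongrightarrow> D' ?w) (at 0)" .
    have at_w: "D' ?w = (1/2) *s (v + v') + ((s - s')\<^sup>2 / 4) *s D' b"
    proof -
      have w: "?w = (1/2) *s (D v + D v') + ((s - s')\<^sup>2 / 4) *s b"
        by (simp add: vec_eq_iff \<sigma>_def field_simps power2_eq_square)
      show ?thesis
        unfolding w by (simp only: linear_add[OF has_derivative_linear[OF D'(1)]] D'(2) D'D)
    qed
    have "eventually (\<lambda>t. (1 / t\<^sup>2) *s (g (?h t) - g (f (?l t)))
        = (1 / t\<^sup>2) *s (g (?h t) - ?l t)) (at 0)"
      using topological_tendstoD[OF line[of \<sigma>] f(2) z] by eventually_elim (simp add: gf)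
    from Lim_transform_eventually[OF lim this] show "((\<lambda>t. (1 / t\<^sup>2) *s (g (?h t) - (z + (t * ((s + s') / 2)) *s u)))
        \<longlongrightarrow> (1/2) *s (v + v') + ((s - s')\<^sup>2 / 4) *s D' b) (at 0)"
      unfolding at_w unfolding \<sigma>_def .
  qed
qed

section \<open>Holomorphic curves of midpoints\<close>

lemma has_derivative_scaled_vector:
  fixes v :: "complex ^ 'n"
  assumes "(c has_field_derivative c') (at t)"
  shows "((\<lambda>t. c t *s v) has_derivative (\<lambda>h. h *s (c' *s v))) (at t)"
proof -
  have "((\<lambda>t. c t *s v) has_derivative (\<lambda>h. (c' * h) *s v)) (at t)"
    using assms has_derivative_vector_scalar_mult_left
    unfolding has_field_derivative_def by (rule has_derivative_compose)
  then show ?thesis by (simp add: mult.commute)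
qed

lemma holomorphic_curve_image:
  fixes f :: "complex ^ 'n \<Rightarrow> complex ^ 'm"
  assumes f: "holomorphic_map_on f U" "open U" "c t \<in> U"
    and c: "(c has_derivative (\<lambda>h. h *s w)) (at t)"
  shows "\<exists>w'. ((\<lambda>t. f (c t)) has_derivative (\<lambda>h. h *s w')) (at t)"
proof -
  obtain D where D: "(f has_derivative D) (at (c t))" "\<And>a v. D (a *s v) = a *s D v"
    using holomorphic_map_onE[OF f] by metis
  have "((\<lambda>t. f (c t)) has_derivative (\<lambda>h. D (h *s w))) (at t)"
    using c D(1) by (rule has_derivative_compose)
  then show ?thesis unfolding D(2) by blast
qed

lemma holomorphic_on_vec_nth:
  fixes c :: "complex \<Rightarrow> complex ^ 'n"
  assumes "\<And>t. t \<in> N \<Longrightarrow> \<exists>w. (c has_derivative (\<lambda>h. h *s w)) (at t)"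
  shows "(\<lambda>t. c t $ i) holomorphic_on N"
  unfolding holomorphic_on_def
proof
  fix t assume "t \<in> N"
  then obtain w where "(c has_derivative (\<lambda>h. h *s w)) (at t)"
    using assms by blast
  then have "((\<lambda>t. c t $ i) has_derivative (\<lambda>h. (h *s w) $ i)) (at t)"
    by (rule bounded_linear.has_derivative[OF bounded_linear_vec_nth])
  moreover have "(\<lambda>h. (h *s w) $ i) = (*) (w $ i)"
    by (simp add: fun_eq_iff)
  ultimately have "((\<lambda>t. c t $ i) has_field_derivative w $ i) (at t)"
    by (simp add: has_field_derivative_def)
  then show "(\<lambda>t. c t $ i) field_differentiable at t within N"
    using field_differentiable_at_within field_differentiable_def by blast
qed

lemma half_vector_scalar_mult:
  fixes x :: "complex ^ 'n"
  shows "(1/2) *s x = (1/2) *\<^sub>R x"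
  unfolding vec_eq_iff vector_scaleR_component vector_smult_component
  by (simp add: scaleR_conv_of_real)

text \<open>
  Holomorphic curves are described by the requirement that their derivative is multiplication of
  a fixed vector by the increment; this form passes through sums and through holomorphic maps.
\<close>

lemma holomorphic_midpoint_curve:
  fixes f :: "complex ^ 'n \<Rightarrow> complex ^ 'm" and g :: "complex ^ 'm \<Rightarrow> complex ^ 'k"
  assumes f: "holomorphic_map_on f U" "open U" and g: "holomorphic_map_on g V" "open V"
    and c: "\<And>t. t \<in> N \<Longrightarrow> c t \<in> U" "\<And>t. t \<in> N \<Longrightarrow> \<exists>w. (c has_derivative (\<lambda>h. h *s w)) (at t)"
    and d: "\<And>t. t \<in> N \<Longrightarrow> d t \<in> U" "\<And>t. t \<in> N \<Longrightarrow> \<exists>w. (d has_derivative (\<lambda>h. h *s w)) (at t)"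
    and mid: "\<And>t. t \<in> N \<Longrightarrow> (1/2) *s (f (c t) + f (d t)) \<in> V"
  shows "(\<lambda>t. g ((1/2) *s (f (c t) + f (d t))) $ i) holomorphic_on N"
proof (rule holomorphic_on_vec_nth)
  fix t assume t: "t \<in> N"
  obtain w where w: "((\<lambda>t. f (c t)) has_derivative (\<lambda>h. h *s w)) (at t)"
    using c[OF t] holomorphic_curve_image[OF f] by blast
  obtain w' where w': "((\<lambda>t. f (d t)) has_derivative (\<lambda>h. h *s w')) (at t)"
    using d[OF t] holomorphic_curve_image[OF f] by blast
  have "((\<lambda>t. (1/2) *s (f (c t) + f (d t))) has_derivative (\<lambda>h. (1/2) *s (h *s w + h *s w'))) (at t)"
    unfolding half_vector_scalar_mult by (intro has_derivative_scaleR_right has_derivative_add w w')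
  moreover have "(1/2) *s (h *s w + h *s w') = h *s ((1/2) *s (w + w'))" for h
    by (simp add: vec_eq_iff field_simps)
  ultimately have "((\<lambda>t. (1/2) *s (f (c t) + f (d t))) has_derivative (\<lambda>h. h *s ((1/2) *s (w + w')))) (at t)"
    by (simp only:)
  then show "\<exists>w. ((\<lambda>t. g ((1/2) *s (f (c t) + f (d t)))) has_derivative (\<lambda>h. h *s w)) (at t)"
    by (rule holomorphic_curve_image[OF g, where c = "\<lambda>t. (1/2) *s (f (c t) + f (d t))", OF mid[OF t]])
qed

lemma convex_midpoint:
  fixes C :: "(complex ^ 'n) set"
  assumes "convex C" "x \<in> C" "y \<in> C"
  shows "(1/2) *s (x + y) \<in> C"
  unfolding half_vector_scalar_mult scaleR_add_right using assms by (intro convexD) auto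

section \<open>Holomorphic inequalities on the symmetrized bidisc\<close>

lemma symmetrized_bidiscD:
  assumes "(s, p) \<in> symmetrized_bidisc" "norm z \<le> 1"
  shows "1 - s * z + p * z\<^sup>2 \<noteq> 0"
  using assms by (simp add: symmetrized_bidisc_def)

lemma symmetrized_bidiscE:
  assumes "(s, p) \<in> symmetrized_bidisc"
  obtains a b where "s = a + b" "p = a * b" "norm a < 1" "norm b < 1"
proof -
  define d where "d = csqrt (s\<^sup>2 - 4 * p)"
  define a where "a = (s + d) / 2"
  define b where "b = (s - d) / 2"
  have d2: "d\<^sup>2 = s\<^sup>2 - 4 * p" by (simp add: d_def)
  have s: "s = a + b" by (simp add: a_def b_def field_simps)
  have "a * b = (s\<^sup>2 - d\<^sup>2) / 4" by (simp add: a_def b_def field_simps power2_eq_square)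
  then have p: "p = a * b" by (simp add: d2)
  have inside: "norm c < 1" if "c = a \<or> c = b" for c
  proof (rule ccontr)
    assume "\<not> norm c < 1"
    then have "c \<noteq> 0" "1 \<le> norm c" by auto
    then have "norm (1 / c) \<le> 1" by (simp add: norm_divide)
    then have "1 - s * (1 / c) + p * (1 / c)\<^sup>2 \<noteq> 0"
      by (rule symmetrized_bidiscD[OF assms])
    moreover have "1 - s * (1 / c) + p * (1 / c)\<^sup>2 = 0"
      using that \<open>c \<noteq> 0\<close> by (auto simp: s p field_simps power2_eq_square)
    ultimately show False by simp
  qed
  show ?thesis using that[OF s p] inside by blast
qed

lemma symmetrized_bidiscI:
  assumes "norm a < 1" "norm b < 1"
  shows "(a + b, a * b) \<in> symmetrized_bidisc"
proof -
  have "1 - (a + b) * z + a * b * z\<^sup>2 \<noteq> 0" if z: "norm z \<le> 1" for z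
  proof
    assume "1 - (a + b) * z + a * b * z\<^sup>2 = 0"
    then have "(1 - a * z) * (1 - b * z) = 0"
      by (simp add: algebra_simps power2_eq_square)
    then obtain c where c: "c * z = 1" "norm c < 1"
      using assms by auto
    have "norm (c * z) < 1"
      using mult_mono[of "norm c" "norm c" "norm z" 1] c(2) z by (simp add: norm_mult)
    then show False using c(1) by simp
  qed
  then show ?thesis by (simp add: symmetrized_bidisc_def)
qed

lemma symmetrized_bidisc_rotate:
  assumes "(l * s, l\<^sup>2 * p) \<in> symmetrized_bidisc" "norm l = 1"
  shows "(s, p) \<in> symmetrized_bidisc"
proof -
  have "l \<noteq> 0" using assms(2) by auto
  have "1 - s * z + p * z\<^sup>2 \<noteq> 0" if "norm z \<le> 1" for z
  proof -
    have "norm (z / l) \<le> 1" using that assms(2) by (simp add: norm_divide)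
    then have "1 - (l * s) * (z / l) + (l\<^sup>2 * p) * (z / l)\<^sup>2 \<noteq> 0"
      by (rule symmetrized_bidiscD[OF assms(1)])
    then show ?thesis using \<open>l \<noteq> 0\<close> by (simp add: power_divide)
  qed
  then show ?thesis by (simp add: symmetrized_bidisc_def)
qed

text \<open>
  With \<open>s = u + v\<close> and \<open>p = u v\<close> the bound says that \<open>(2 p - s) / (2 - s)\<close> maps the symmetrized
  bidisc into the closed unit disc. Substituting \<open>U = u / (1 - u)\<close> and \<open>V = v / (1 - v)\<close> turns it into
  \<open>norm (U + V) \<le> norm (2 + U + V)\<close>, which holds because \<open>U\<close> and \<open>V\<close> have real part at least
  \<open>- 1 / 2\<close>. Clearing denominators gives the identity between squared norms used here, which
  covers \<open>u = 1\<close> and \<open>v = 1\<close> as well.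
\<close>

lemma magic_function_bound:
  fixes u v :: complex
  assumes "norm u \<le> 1" "norm v \<le> 1"
  shows "norm (2 * (u * v) - (u + v)) \<le> norm (2 - (u + v))"
proof -
  have "(norm (2 - (u + v)))\<^sup>2 - (norm (2 * (u * v) - (u + v)))\<^sup>2
      = 2 * ((1 - (norm u)\<^sup>2) * (norm (1 - v))\<^sup>2 + (1 - (norm v)\<^sup>2) * (norm (1 - u))\<^sup>2)"
    unfolding cmod_power2 by (simp add: power2_eq_square algebra_simps)
  also have "\<dots> \<ge> 0"
    using assms by (intro mult_nonneg_nonneg add_nonneg_nonneg) (simp_all add: power_le_one)
  finally have "(norm (2 * (u * v) - (u + v)))\<^sup>2 \<le> (norm (2 - (u + v)))\<^sup>2"
    by simp
  then show ?thesis
    by (rule power2_le_imp_le) simp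
qed

lemma symmetrized_bidisc_bounds:
  assumes "(s, p) \<in> symmetrized_bidisc"
  shows "norm s < 2"
    and "norm t \<le> 1 \<Longrightarrow> norm (2 * (t\<^sup>2 * p) - t * s) \<le> norm (2 - t * s)"
proof -
  obtain a b where ab: "s = a + b" "p = a * b" "norm a < 1" "norm b < 1"
    using assms by (rule symmetrized_bidiscE)
  show "norm s < 2" using norm_triangle_ineq[of a b] ab by simp
  assume "norm t \<le> 1"
  then have "norm (t * a) \<le> 1" "norm (t * b) \<le> 1"
    using ab by (auto simp: norm_mult mult_le_one)
  from magic_function_bound[OF this]
  show "norm (2 * (t\<^sup>2 * p) - t * s) \<le> norm (2 - t * s)"
    by (simp add: ab algebra_simps power2_eq_square)
qed

lemma holomorphic_on_removable_at_0:
  fixes F :: "complex \<Rightarrow> complex"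
  assumes "F holomorphic_on N - {0}" "open N" "(F \<longlongrightarrow> l) (at 0)"
  shows "(\<lambda>t. if t = 0 then l else F t) holomorphic_on N"
proof (rule no_isolated_singularity'[where K = "{0}"])
  let ?F = "\<lambda>t. if t = 0 then l else F t"
  have "eventually (\<lambda>t. F t = ?F t) (at 0)"
    by (simp add: eventually_at_filter)
  with assms(3) have "(?F \<longlongrightarrow> l) (at 0)"
    by (rule Lim_transform_eventually)
  then show "(?F \<longlongrightarrow> ?F z) (at z within N)" if "z \<in> {0}" for z
    using that by (auto intro: tendsto_within_subset)
  show "?F holomorphic_on N - {0}"
    by (rule holomorphic_transform[OF assms(1)]) simp
qed (use assms(2) in auto)

lemma norm_le_on_unit_disc:
  fixes F :: "complex \<Rightarrow> complex"
  assumes "F holomorphic_on N" "cball 0 1 \<subseteq> N" "\<And>l. norm l = 1 \<Longrightarrow> norm (F l) \<le> B" "norm z \<le> 1"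
  shows "norm (F z) \<le> B"
proof (rule maximum_modulus_frontier[where f = F and S = "cball 0 1"])
  show "F holomorphic_on interior (cball 0 1)"
    using assms(2) interior_subset by (intro holomorphic_on_subset[OF assms(1)]) blast
  show "continuous_on (closure (cball 0 1)) F"
    using holomorphic_on_imp_continuous_on[OF holomorphic_on_subset[OF assms(1,2)]] by simp
qed (use assms(3,4) in \<open>auto simp: dist_norm\<close>)

text \<open>
  If the boundary of a holomorphic disc lies in the symmetrized bidisc, then the values of \<open>S\<close>
  and \<open>P\<close> at the center satisfy the inequality that holds on the boundary. The quotient of the
  two sides is a holomorphic function on the disc: its denominator has no zero because the
  maximum principle gives \<open>norm (S l) \<le> 2\<close> inside, and \<open>norm t < 1\<close>. The maximum principle for
  the quotient then gives the claim.
\<close>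

lemma analytic_disc_center_bound:
  assumes hol: "S holomorphic_on N" "P holomorphic_on N" and N: "cball 0 1 \<subseteq> N"
    and circle: "\<And>l. norm l = 1 \<Longrightarrow> (S l, P l) \<in> symmetrized_bidisc"
    and t: "norm t < 1"
  shows "norm (2 * (t\<^sup>2 * P 0) - t * S 0) \<le> norm (2 - t * S 0)"
proof -
  have S2: "norm (S l) \<le> 2" if "norm l \<le> 1" for l
    by (rule norm_le_on_unit_disc[OF hol(1) N _ that]) (use symmetrized_bidisc_bounds(1)[OF circle] in \<open>auto intro: less_imp_le\<close>)
  have ne: "2 - t * S l \<noteq> 0" if "norm l \<le> 1" for l
  proof
    assume "2 - t * S l = 0"
    then have "2 = norm t * norm (S l)" by (simp flip: norm_mult)
    also have "\<dots> \<le> norm t * 2" using S2[OF that] by (simp add: mult_left_mono)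
    also have "\<dots> < 2" using t by simp
    finally show False by simp
  qed
  let ?F = "\<lambda>l. (2 * (t\<^sup>2 * P l) - t * S l) / (2 - t * S l)"
  have "norm (?F 0) \<le> 1"
  proof (rule norm_le_on_unit_disc[where F = ?F and N = "cball 0 1"])
    show "?F holomorphic_on cball 0 1"
      using ne by (intro holomorphic_intros holomorphic_on_subset[OF hol(1) N]
          holomorphic_on_subset[OF hol(2) N]) auto
    fix l :: complex assume "norm l = 1"
    then show "norm (?F l) \<le> 1"
      using symmetrized_bidisc_bounds(2)[OF circle, of l t] t by (simp add: norm_divide divide_le_eq_1)
  qed auto
  then show ?thesis
    using ne[of 0] by (simp add: norm_divide divide_le_eq_1 split: if_splits)
qed

section \<open>The slice of the pentablock over the symmetrized bidisc\<close>

lemma pentablock_projection: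
  "x \<in> pentablock \<Longrightarrow> (x $ 2, x $ 3) \<in> symmetrized_bidisc"
  by (simp add: pentablock_def Let_def)

text \<open>
  The numerator is \<open>(1 - norm b ^ 2) a + (1 - norm a ^ 2) b\<close>. By the triangle inequality the
  claim becomes a statement about \<open>x = norm a\<close> and \<open>y = norm b\<close>, and after cancelling \<open>1 - x y\<close> it
  reads \<open>x + y < 1 + x y\<close>.
\<close>

lemma norm_pentablock_beta_less_one:
  assumes "norm a < 1" "norm b < 1"
  shows "norm (pentablock_beta (a + b) (a * b)) < 1"
proof -
  let ?x = "norm a" and ?y = "norm b"
  have xy: "?x * ?y < 1"
    using mult_strict_mono[of ?x 1 ?y 1] assms by simp
  have sq: "?x\<^sup>2 < 1" "?y\<^sup>2 < 1"
    using assms by (simp_all add: power_less_one_iff)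
  have den: "(norm (a * b))\<^sup>2 < 1"
    using xy by (simp add: norm_mult power_less_one_iff)
  have "of_real (1 - (norm z)\<^sup>2) = 1 - z * cnj z" for z :: complex
    by (simp only: of_real_diff of_real_1 complex_norm_square)
  note this[simp]
  have "a + b - cnj (a + b) * (a * b) = of_real (1 - ?y\<^sup>2) * a + of_real (1 - ?x\<^sup>2) * b"
    by (simp add: algebra_simps del: of_real_diff)
  also have "norm \<dots> \<le> (1 - ?y\<^sup>2) * ?x + (1 - ?x\<^sup>2) * ?y"
    using norm_triangle_ineq sq by (smt (verit) norm_mult norm_of_real)
  also have "\<dots> = (?x + ?y) * (1 - ?x * ?y)"
    by (simp add: algebra_simps power2_eq_square)
  also have "\<dots> < (1 + ?x * ?y) * (1 - ?x * ?y)"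
  proof (rule mult_strict_right_mono)
    have "(1 - ?x) * (1 - ?y) > 0" using assms by simp
    then show "?x + ?y < 1 + ?x * ?y" by (simp add: algebra_simps)
  qed (use xy in simp)
  also have "\<dots> = 1 - (norm (a * b))\<^sup>2"
    by (simp add: algebra_simps power2_eq_square norm_mult)
  finally have "norm (a + b - cnj (a + b) * (a * b)) < 1 - (norm (a * b))\<^sup>2" .
  moreover have "norm (of_real (1 - (norm (a * b))\<^sup>2) :: complex) = 1 - (norm (a * b))\<^sup>2"
    unfolding norm_of_real using den by simp
  ultimately show ?thesis
    unfolding pentablock_beta_def norm_divide using den by (simp only: divide_less_eq_1_pos diff_gt_0_iff_gt)
qed

text \<open>
  For first coordinate \<open>0\<close> the defining inequality only asks that the right-hand side does not
  vanish. The subtracted term has norm below \<open>1\<close>, since \<open>s\<close> is smaller than \<open>2\<close>, \<open>\<beta>\<close> is smaller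
  than \<open>1\<close>, and the denominator is at least \<open>1\<close>. Together with the projection onto the last two
  coordinates this reduces questions about the pentablock to the symmetrized bidisc.
\<close>

lemma pentablock_sliceI:
  assumes "x $ 1 = 0" "x $ 2 = a + b" "x $ 3 = a * b" and ab: "norm a < 1" "norm b < 1"
  shows "x \<in> pentablock"
proof -
  define \<beta> where "\<beta> = pentablock_beta (a + b) (a * b)"
  define k where "k = 1 + sqrt (1 - (norm \<beta>)\<^sup>2)"
  have \<beta>: "norm \<beta> < 1" using norm_pentablock_beta_less_one[OF ab] by (simp add: \<beta>_def)
  then have k: "k \<ge> 1" by (simp add: k_def power_le_one)
  have s: "norm (a + b) < 2"
    using symmetrized_bidisc_bounds(1)[OF symmetrized_bidiscI[OF ab]] .
  let ?w = "(1/2 * (a + b) * cnj \<beta>) / of_real k"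
  have "norm (a + b) * norm \<beta> \<le> norm (a + b) * 1"
    using \<beta> by (intro mult_left_mono) auto
  then have num: "norm (1/2 * (a + b) * cnj \<beta>) < 1"
    using s by (simp add: norm_mult norm_divide)
  have "norm ?w < 1"
    unfolding norm_divide norm_of_real using num k by (simp add: divide_less_eq_1_pos)
  then have "?w \<noteq> 1" by auto
  then have "0 < norm (1 - ?w)" by simp
  then show ?thesis
    using symmetrized_bidiscI[OF ab] assms(1-3)
    by (simp add: pentablock_def Let_def \<beta>_def k_def)
qed

text \<open>
  The orbit of \<open>(0, s, p)\<close> under the weighted action \<open>t \<cdot> (a, s, p) = (a, t s, t\<^sup>2 p)\<close>. It is
  written as a sum of a linear and a quadratic vector term to match the curves whose midpoints
  are expanded above.
\<close>

definition slice_orbit :: "complex \<Rightarrow> complex \<Rightarrow> complex \<Rightarrow> complex ^ 3" where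
  "slice_orbit s p t = (t * s) *s axis 2 1 + t\<^sup>2 *s (p *s axis 3 1)"

lemma slice_orbit_nth [simp]:
  "slice_orbit s p t $ 1 = 0" "slice_orbit s p t $ 2 = t * s" "slice_orbit s p t $ 3 = t\<^sup>2 * p"
  by (simp_all add: slice_orbit_def axis_def)

lemma has_derivative_slice_orbit:
  "\<exists>w. (slice_orbit s p has_derivative (\<lambda>h. h *s w)) (at t)"
proof -
  have "((\<lambda>t. (t * s) *s axis 2 1 + t\<^sup>2 *s (p *s axis 3 1) :: complex ^ 3) has_derivative
     (\<lambda>h. h *s (s *s axis 2 1) + h *s ((2 * t) *s (p *s axis 3 1)))) (at t)"
    by (intro has_derivative_add has_derivative_scaled_vector) (auto intro!: derivative_eq_intros)
  then show ?thesis
    unfolding slice_orbit_def[abs_def] vector_add_ldistrib[symmetric] by blast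
qed

lemma slice_orbit_continuous: "continuous_on UNIV (slice_orbit s p)"
  using has_derivative_slice_orbit has_derivative_continuous
  by (metis continuous_at_imp_continuous_on)

text \<open>
  The weighted action scales the two roots of the symmetrized bidisc by \<open>t\<close>.
\<close>

lemma slice_orbit_in_pentablock:
  assumes "norm a < 1" "norm b < 1" "norm t \<le> 1"
  shows "slice_orbit (a + b) (a * b) t \<in> pentablock"
proof (rule pentablock_sliceI)
  show "norm (t * a) < 1" "norm (t * b) < 1"
    using assms mult_le_less_imp_less[of "norm t" 1 "norm a" 1] mult_le_less_imp_less[of "norm t" 1 "norm b" 1]
    by (auto simp: norm_mult intro: le_less_trans[OF mult_left_le_one_le])
qed (simp_all add: algebra_simps power2_eq_square)

section \<open>Convexity forces a shear\<close>

text \<open>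
  Let \<open>f\<close> map \<open>E\<close> onto the convex domain. For two orbits in \<open>E\<close> the midpoint curve \<open>\<phi>\<close> stays in
  \<open>E\<close>, hence projects into the symmetrized bidisc. It starts as \<open>(t \<sigma>, t\<^sup>2 \<pi>)\<close>, where \<open>\<sigma>\<close> is the
  mean of \<open>s\<close> and \<open>s'\<close> and \<open>\<pi>\<close> is the mean of \<open>p\<close> and \<open>p'\<close>, sheared by \<open>(s - s')\<^sup>2 k / 4\<close>. Undoing the
  weighted action on the unit circle gives a holomorphic disc with center \<open>(\<sigma>, \<pi>)\<close> whose
  boundary lies in the symmetrized bidisc. In the coordinates \<open>(s, p + k s\<^sup>2)\<close> the point
  \<open>(\<sigma>, \<pi>)\<close> is the midpoint of \<open>(s, p)\<close> and \<open>(s', p')\<close>; this shear depends on the convex domain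
  but not on the two orbits.
\<close>

lemma sheared_midpoint_bound:
  assumes E: "open E" "E \<subseteq> pentablock" "0 \<in> E"
    and C: "biholomorphic E C" "open C" "convex C"
  obtains k where
    "\<And>s p s' p' t. \<lbrakk>\<And>l. norm l \<le> 1 \<Longrightarrow> slice_orbit s p l \<in> E;
        \<And>l. norm l \<le> 1 \<Longrightarrow> slice_orbit s' p' l \<in> E; norm t < 1\<rbrakk> \<Longrightarrow>
      norm (2 * (t\<^sup>2 * ((p + p') / 2 + (s - s')\<^sup>2 / 4 * k)) - t * ((s + s') / 2))
        \<le> norm (2 - t * ((s + s') / 2))"
proof -
  obtain f g where f: "holomorphic_map_on f E" and g: "holomorphic_map_on g C"
    and im: "f ` E = C" "g ` C = E" and gf: "\<And>z. z \<in> E \<Longrightarrow> g (f z) = z"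
    using C(1) unfolding biholomorphic_def by blast
  have maps: "f w \<in> C \<and> g (f w) = w" if "w \<in> E" for w
    using im gf that by blast
  let ?e2 = "axis 2 1 :: complex ^ 3" and ?e3 = "axis 3 1 :: complex ^ 3"
  let ?mid = "\<lambda>s p s' p' t. g ((1/2) *s (f (slice_orbit s p t) + f (slice_orbit s' p' t)))"
  obtain q where q: "\<And>s s' v v'. ((\<lambda>t. (1 / t\<^sup>2) *s
        (g ((1/2) *s (f (0 + (t * s) *s ?e2 + t\<^sup>2 *s v) + f (0 + (t * s') *s ?e2 + t\<^sup>2 *s v')))
          - (0 + (t * ((s + s') / 2)) *s ?e2)))
      \<longlongrightarrow> (1/2) *s (v + v') + ((s - s')\<^sup>2 / 4) *s q) (at 0)"
    using midpoint_curve_expansion[OF f E(1,3) g C(2) maps, of ?e2] by blast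
  show ?thesis
  proof
    fix s p s' p' t :: complex
    assume orb: "\<And>l. norm l \<le> 1 \<Longrightarrow> slice_orbit s p l \<in> E"
      "\<And>l. norm l \<le> 1 \<Longrightarrow> slice_orbit s' p' l \<in> E" and t: "norm t < 1"
    define \<phi> where "\<phi> = ?mid s p s' p'"
    define \<sigma> where "\<sigma> = (s + s') / 2"
    define \<pi> where "\<pi> = (p + p') / 2 + (s - s')\<^sup>2 / 4 * q $ 3"
    define N where "N = slice_orbit s p -` E \<inter> slice_orbit s' p' -` E"
    have N: "open N" "cball 0 1 \<subseteq> N"
      using orb open_vimage[OF E(1) slice_orbit_continuous] by (auto simp: N_def dist_norm)
    have inC: "(1/2) *s (f (slice_orbit s p t) + f (slice_orbit s' p' t)) \<in> C" if "t \<in> N" for t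
      using that maps by (intro convex_midpoint C(3)) (auto simp: N_def)
    have \<phi>_bidisc: "(\<phi> t $ 2, \<phi> t $ 3) \<in> symmetrized_bidisc" if "t \<in> N" for t
      using inC[OF that] im(2) E(2) unfolding \<phi>_def by (intro pentablock_projection) blast
    have hol: "(\<lambda>t. \<phi> t $ i) holomorphic_on N" for i
      unfolding \<phi>_def
      by (rule holomorphic_midpoint_curve[OF f E(1) g C(2)])
        (use inC has_derivative_slice_orbit in \<open>auto simp: N_def\<close>)
    have lim: "((\<lambda>t. (1 / t\<^sup>2) * (\<phi> t $ i - t * \<sigma> * ?e2 $ i)) \<longlongrightarrow>
        ((p + p') / 2) * ?e3 $ i + ((s - s')\<^sup>2 / 4) * q $ i) (at 0)" for i
    proof -
      have limit: "((1/2) *s (p *s ?e3 + p' *s ?e3) + ((s - s')\<^sup>2 / 4) *s q) $ i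
          = ((p + p') / 2) * ?e3 $ i + ((s - s')\<^sup>2 / 4) * q $ i"
        by (simp add: field_simps)
      show ?thesis
        using tendsto_vec_nth[OF q[of s "p *s ?e3" s' "p' *s ?e3"], of i]
        unfolding limit \<phi>_def \<sigma>_def slice_orbit_def
        by (simp only: add_0 vector_smult_component vector_minus_component)
    qed
    have lim3: "((\<lambda>t. \<phi> t $ 3 / t\<^sup>2) \<longlongrightarrow> \<pi>) (at 0)"
      using lim[of 3] by (simp add: axis_def \<pi>_def)
    \<comment> \<open>The first-order term of the second coordinate follows from the second-order statement
      after multiplication by \<open>t\<close>.\<close>
    have lim2: "((\<lambda>t. \<phi> t $ 2 / t) \<longlongrightarrow> \<sigma>) (at 0)"
    proof -
      have "((\<lambda>t. \<sigma> + t * ((1 / t\<^sup>2) * (\<phi> t $ 2 - t * \<sigma> * ?e2 $ 2))) \<longlongrightarrow>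
          \<sigma> + 0 * (((p + p') / 2) * ?e3 $ 2 + ((s - s')\<^sup>2 / 4) * q $ 2)) (at 0)"
        by (intro tendsto_intros lim)
      then have *: "((\<lambda>t. \<sigma> + t * ((1 / t\<^sup>2) * (\<phi> t $ 2 - t * \<sigma>))) \<longlongrightarrow> \<sigma>) (at 0)"
        by (simp add: axis_def)
      have "\<sigma> + t * ((1 / t\<^sup>2) * (\<phi> t $ 2 - t * \<sigma>)) = \<phi> t $ 2 / t" if "t \<noteq> 0" for t
        using that by (simp add: field_simps power2_eq_square)
      then show ?thesis
        by (intro Lim_transform_eventually[OF *]) (simp add: eventually_at_filter)
    qed
    define S where "S = (\<lambda>t. if t = 0 then \<sigma> else \<phi> t $ 2 / t)"
    define P where "P = (\<lambda>t. if t = 0 then \<pi> else \<phi> t $ 3 / t\<^sup>2)"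
    have hol': "(\<lambda>t. \<phi> t $ i) holomorphic_on N - {0}" for i
      using hol by (rule holomorphic_on_subset) auto
    have "S holomorphic_on N" "P holomorphic_on N"
      unfolding S_def P_def
      by (auto intro!: holomorphic_on_removable_at_0 N lim2 lim3 holomorphic_intros hol')
    then have "norm (2 * (t\<^sup>2 * P 0) - t * S 0) \<le> norm (2 - t * S 0)"
    proof (rule analytic_disc_center_bound[where S = S and P = P, OF _ _ N(2) _ t])
      fix l :: complex assume l: "norm l = 1"
      then have "l \<noteq> 0" "l \<in> N" using N(2) by auto
      then have "(l * S l, l\<^sup>2 * P l) \<in> symmetrized_bidisc"
        using \<phi>_bidisc[of l] by (simp add: S_def P_def)
      then show "(S l, P l) \<in> symmetrized_bidisc"
        using l by (rule symmetrized_bidisc_rotate)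
    qed
    then show "norm (2 * (t\<^sup>2 * ((p + p') / 2 + (s - s')\<^sup>2 / 4 * q $ 3)) - t * ((s + s') / 2))
        \<le> norm (2 - t * ((s + s') / 2))"
      by (simp add: S_def P_def \<sigma>_def \<pi>_def)
  qed
qed

lemma compact_subset_of_increasing_union:
  fixes E :: "nat \<Rightarrow> 'a::topological_space set"
  assumes K: "compact K" "K \<subseteq> (\<Union>j. E j)" and E: "\<And>j. open (E j)" "\<And>j. E j \<subseteq> E (Suc j)"
  obtains j where "K \<subseteq> E j"
proof -
  obtain J where J: "finite J" "K \<subseteq> (\<Union>j\<in>J. E j)"
    by (rule compactE_image[OF K(1) E(1) K(2)])
  have "E j \<subseteq> E (Max J)" if "j \<in> J" for j
    by (rule lift_Suc_mono_le[of E, OF E(2)]) (simp add: J(1) that)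
  then have "K \<subseteq> E (Max J)" using J(2) by blast
  then show ?thesis using that by blast
qed

section \<open>No shear works\<close>

text \<open>
  The two hypotheses are the bounds obtained from the pairs \<open>(2 r, r\<^sup>2), (0, - r\<^sup>2)\<close> and
  \<open>(2 r, r\<^sup>2), (2 \<i> r, - r\<^sup>2)\<close>, whose sheared midpoints are \<open>(r, r\<^sup>2 k)\<close> and
  \<open>(r (1 + \<i>), - 2 \<i> r\<^sup>2 k)\<close>. For \<open>r = 1\<close> and \<open>t\<close> on the unit circle with \<open>t \<sigma>\<close> positive, the first
  bound reads \<open>norm (2 k - 1) \<le> 1\<close> and gives \<open>Re k \<ge> 0\<close>, while the second reads
  \<open>norm (4 k + \<surd>2) \<le> 2 - \<surd>2\<close> and gives \<open>Re k < 0\<close>. The slack between the two leaves room for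
  the rational parameters chosen here, which keep the points inside the open domain.
\<close>

lemma sheared_bidisc_not_convex:
  fixes k :: complex and r :: real
  assumes r_def: "r = 19/20"
    and 1: "\<And>t::complex. norm t < 1 \<Longrightarrow> norm (2 * (t\<^sup>2 * (r\<^sup>2 * k)) - t * r) \<le> norm (2 - t * r)"
    and 2: "\<And>t::complex. norm t < 1 \<Longrightarrow>
      norm (2 * (t\<^sup>2 * (- 2 * \<i> * r\<^sup>2 * k)) - t * (r * (1 + \<i>))) \<le> norm (2 - t * (r * (1 + \<i>)))"
  shows False
proof -
  \<comment> \<open>The parameter makes \<open>t r = 9/10\<close>.\<close>
  have "norm (complex_of_real (81/50) * k - of_real (9/10)) \<le> norm (complex_of_real (11/10))"
    using 1[of "18/19"] by (simp add: r_def power2_eq_square)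
  then have a: "9/10 - 81/50 * Re k \<le> 11/10"
    using complex_Re_le_cmod[of "of_real (9/10) - of_real (81/50) * k"] 
    by (simp add: norm_minus_commute del: of_real_divide)
  \<comment> \<open>The direction \<open>1 - \<i>\<close> makes \<open>t r (1 + \<i>) = 13/10\<close> real; the modulus is just below \<open>1\<close>.\<close>
  let ?t = "(13/19) * (1 - \<i>)"
  have "(norm ?t)\<^sup>2 = 338/361"
    unfolding cmod_power2 by (simp add: power2_eq_square)
  then have "(norm ?t)\<^sup>2 < 1\<^sup>2" by simp
  then have t: "norm ?t < 1" by (rule power2_less_imp_less) simp
  have t2: "?t * (r * (1 + \<i>)) = of_real (13/10)" "?t\<^sup>2 * (- 2 * \<i> * r\<^sup>2 * k) = - of_real (169/100) * k"
    by (auto simp: r_def complex_eq_iff power2_eq_square algebra_simps)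
  have "norm (- complex_of_real (169/50) * k - of_real (13/10)) \<le> norm (complex_of_real (7/10))"
    using 2[OF t] unfolding t2 by simp
  then have b: "169/50 * Re k + 13/10 \<le> 7/10"
    using complex_Re_le_cmod[of "- (- of_real (169/50) * k - of_real (13/10))"]
    unfolding norm_minus_cancel norm_of_real by simp
  from a b show False by simp
qed

theorem theorem5p1:
  shows "\<not> exhausted_by_biholomorphically_convex pentablock"
proof
  assume "exhausted_by_biholomorphically_convex pentablock"
  then obtain E where dom: "\<And>j. domain_in (E j)" and mono: "\<And>j. E j \<subseteq> E (Suc j)"
    and union: "(\<Union>j. E j) = pentablock"
    and conv: "\<And>j. \<exists>C :: (complex ^ 3) set. domain_in C \<and> convex C \<and> biholomorphic (E j) C"
    unfolding exhausted_by_biholomorphically_convex_def by blast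
  have op: "open (E j)" for j using dom by (simp add: domain_in_def)
  define r :: real where "r = 19/20"
  let ?K = "slice_orbit (2 * r) (r\<^sup>2) ` cball 0 1 \<union> slice_orbit 0 (- r\<^sup>2) ` cball 0 1"
  have "compact ?K"
    by (intro compact_Un compact_continuous_image continuous_on_subset[OF slice_orbit_continuous] compact_cball subset_UNIV)
  moreover have "?K \<subseteq> (\<Union>j. E j)"
    unfolding union
    using slice_orbit_in_pentablock[of "of_real r" "of_real r"] slice_orbit_in_pentablock[of "of_real r" "- of_real r"]
    by (auto simp: r_def power2_eq_square)
  ultimately obtain j where j: "?K \<subseteq> E j"
    using compact_subset_of_increasing_union[of ?K E] op mono by blast
  obtain C :: "(complex ^ 3) set" where C: "domain_in C" "convex C" "biholomorphic (E j) C"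
    using conv by blast
  \<comment> \<open>Both orbits come from roots of modulus \<open>r\<close>: a double root \<open>r\<close>, and the pair \<open>r, - r\<close>.
    The third one needed is the first one rotated by \<open>\<i>\<close>.\<close>
  have double: "slice_orbit (2 * r) (r\<^sup>2) l \<in> E j" and opposite: "slice_orbit 0 (- r\<^sup>2) l \<in> E j"
    if "norm l \<le> 1" for l
    using j that by (auto simp: image_subset_iff dist_norm)
  have rotated: "slice_orbit (2 * \<i> * r) (- r\<^sup>2) l \<in> E j" if "norm l \<le> 1" for l
  proof -
    have "slice_orbit (2 * \<i> * r) (- r\<^sup>2) l = slice_orbit (2 * r) (r\<^sup>2) (\<i> * l)"
      by (simp add: slice_orbit_def power_mult_distrib mult.commute mult.left_commute)
    then show ?thesis using double[of "\<i> * l"] that by (simp add: norm_mult)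
  qed
  have "slice_orbit 0 (- r\<^sup>2) 0 = 0" by (simp add: slice_orbit_def)
  then have zero: "0 \<in> E j" using opposite[of 0] by simp
  have sub: "E j \<subseteq> pentablock" using union by blast
  have "open C" using C by (simp add: domain_in_def)
  show False
  proof (rule sheared_midpoint_bound[OF op sub zero C(3) \<open>open C\<close> C(2)])
    fix k
    assume k: "\<And>s p s' p' t. \<lbrakk>\<And>l. norm l \<le> 1 \<Longrightarrow> slice_orbit s p l \<in> E j;
        \<And>l. norm l \<le> 1 \<Longrightarrow> slice_orbit s' p' l \<in> E j; norm t < 1\<rbrakk> \<Longrightarrow>
      norm (2 * (t\<^sup>2 * ((p + p') / 2 + (s - s')\<^sup>2 / 4 * k)) - t * ((s + s') / 2))
        \<le> norm (2 - t * ((s + s') / 2))"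
    have 1: "norm (2 * (t\<^sup>2 * (r\<^sup>2 * k)) - t * r) \<le> norm (2 - t * r)" if t: "norm t < 1" for t :: complex
      using k[OF double opposite t] by (simp add: power_mult_distrib)
    have sq: "(complex_of_real (2 * r) - 2 * \<i> * r)\<^sup>2 = - 8 * \<i> * r\<^sup>2"
      by (simp add: power2_eq_square algebra_simps)
    have mean: "(complex_of_real (2 * r) + 2 * \<i> * r) / 2 = r * (1 + \<i>)"
      by (simp add: algebra_simps)
    have 2: "norm (2 * (t\<^sup>2 * (- 2 * \<i> * r\<^sup>2 * k)) - t * (r * (1 + \<i>)))
        \<le> norm (2 - t * (r * (1 + \<i>)))" if t: "norm t < 1" for t :: complex
      using k[OF double rotated t] unfolding sq mean by simp
    show False
      by (rule sheared_bidisc_not_convex[OF r_def 1 2])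
  qed
qed

end
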